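(* Let $A\in\mathbb{R}^{n\times n}$ be symmetric and indefinite, $a,b\in\mathbb{R}^n$ and $\beta\in\mathbb{R}$. Consider the SOCP/SDP problem (P) in the variables $z,\lambda_0,u_0\in\mathbb{R}$, $u\in\mathbb{R}^n$: $$\max\Big\{z:\ M(z,\lambda_0,u_0,u)\succeq 0,\ \|u\|\le -u_0,\ \lambda_0\ge 0\Big\},$$ $$M(z,\lambda_0,u_0,u)=\begin{pmatrix}-\lambda_0+\beta u_0-z & \tfrac12(2a-\beta u-bu_0)^T\\ \tfrac12(2a-\beta u-bu_0) & A+\lambda_0 I+\tfrac12(bu^T+ub^T)\end{pmatrix},$$ and the SOCP/SDP problem (D) in the variables $x\in\mathbb{R}^n$ and $X\in\mathbb{R}^{n\times n}$ symmetric: $$\min\Big\{A\bullet X+2a^Tx:\ \mathrm{trace}(X)\le 1,\ \|\beta x-Xb\|\le -b^Tx+\beta,\ X\succeq xx^T\Big\}.$$ Then (P) and (D) are dual to each other, in that the Lagrangian dual of (P) is (D). Explicitly, let $$\mathcal{L}=z+M(z,\lambda_0,u_0,u)\bullet Y+\bar v^Tu-v_0u_0,\qquad Y=\begin{pmatrix}\alpha & x^T\\ x & X\end{pmatrix}\succeq 0,\quad \|\bar v\|\le v_0,$$ be the Lagrangian of (P). The Lagrangian dual of (P) is $$\min_{Y\succeq 0,\ \|\bar v\|\le v_0}\ \mathcal{G},\qquad \mathcal{G}=\max_{z\in\mathbb{R},\ \lambda_0\ge 0,\ \|u\|\le -u_0}\ \mathcal{L},$$ where $$\mathcal{G}=\begin{cases}A\bullet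 X+2a^Tx, & \text{if } 1-\alpha=0,\ \mathrm{trace}(X)-\alpha\le 0,\ Xb-\beta x+\bar v=0,\ -b^Tx-v_0+\beta\ge 0,\\ \infty, & \text{otherwise.}\end{cases}$$ Thus the Lagrangian dual becomes $$\min\Big\{A\bullet X+2a^Tx:\ \mathrm{trace}(X)-1\le 0,\ Xb-\beta x+\bar v=0,\ -b^Tx-v_0+\beta\ge 0,\ \|\bar v\|\le v_0,\ X\succeq xx^T\Big\},$$ and this can be written as (D).
   Context: $\|\cdot\|$ is the Euclidean norm, $I$ is the $n\times n$ identity matrix, $M\succeq 0$ means that the symmetric matrix $M$ is positive semidefinite, $X\succeq xx^T$ means $X-xx^T\succeq 0$, and $P\bullet Q=\mathrm{trace}(P^TQ)$ is the trace inner product. The multipliers are $Y$, with $\alpha\in\mathbb{R}$, $x\in\mathbb{R}^n$ and $X\in\mathbb{R}^{n\times n}$ symmetric, and $v=(v_0;\bar v)\in\mathbb{R}\times\mathbb{R}^n$; $\mathcal{G}$ is a function of these multipliers. Both problems arise as formulations of the extended trust region subproblem of minimizing $x^TAx+2a^Tx$ subject to $\|x\|^2\le 1$ and $b^Tx\le\beta$.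
   Formalization: The printed formula for G fails on the domain ‖u‖≤-u0: there Xb-βx+v̄=0, -bᵀx-v0+β≥0 is corrected to ‖Xb-βx+v̄‖≤-bᵀx-v0+β. The printed formula is proved with the inner maximum over u0≤0 and u free. Both duals are shown to be (D). *)

theory Defs
  imports "HOL-Analysis.Analysis"
begin

definition psd :: "real^'m^'m \<Rightarrow> bool" where
  "psd S \<longleftrightarrow> transpose S = S \<and> (\<forall>w. 0 \<le> w \<bullet> (S *v w))"

definition indefinite :: "real^'m^'m \<Rightarrow> bool" where
  "indefinite S \<longleftrightarrow> (\<exists>w. w \<bullet> (S *v w) > 0) \<and> (\<exists>w. w \<bullet> (S *v w) < 0)"

definition outer :: "real^'n \<Rightarrow> real^'n \<Rightarrow> real^'n^'n" where
  "outer u v = (\<chi> i j. u $ i * v $ j)"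

definition frob :: "real^'m^'m \<Rightarrow> real^'m^'m \<Rightarrow> real" (infixl "\<bullet>\<bullet>" 70) where
  "P \<bullet>\<bullet> Q = trace (transpose P ** Q)"

text \<open>The symmetric matrix of order n+1 with corner s, border w and lower right block S.
  Its rows and columns are indexed by the type 'n option, where None is the index 0.\<close>

definition bordered :: "real \<Rightarrow> real^'n \<Rightarrow> real^'n^'n \<Rightarrow> real^('n option)^('n option)" where
  "bordered s w S =
    (\<chi> i j. case i of
        None \<Rightarrow> (case j of None \<Rightarrow> s | Some l \<Rightarrow> w $ l)
      | Some k \<Rightarrow> (case j of None \<Rightarrow> w $ k | Some l \<Rightarrow> S $ k $ l))"

type_synonym 'n primal = "real \<times> real \<times> real \<times> (real^'n)"
  \<comment> \<open>(z, l0, u0, u), where l0 is the variable lambda_0\<close>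

type_synonym 'n multiplier = "real \<times> (real^'n) \<times> (real^'n^'n) \<times> real \<times> (real^'n)"
  \<comment> \<open>(alpha, x, X, v0, vb), where vb is v-bar\<close>

definition M_mat ::
  "real^'n^'n \<Rightarrow> real^'n \<Rightarrow> real^'n \<Rightarrow> real \<Rightarrow> 'n primal \<Rightarrow> real^('n option)^('n option)" where
  "M_mat A a b \<beta> = (\<lambda>(z, l0, u0, u).
     bordered (- l0 + \<beta> * u0 - z)
       ((1/2) *\<^sub>R (2 *\<^sub>R a - \<beta> *\<^sub>R u - u0 *\<^sub>R b))
       (A + l0 *\<^sub>R mat 1 + (1/2) *\<^sub>R (outer b u + outer u b)))"

definition P_feasible ::
  "real^'n^'n \<Rightarrow> real^'n \<Rightarrow> real^'n \<Rightarrow> real \<Rightarrow> 'n primal set" where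
  "P_feasible A a b \<beta> =
     {(z, l0, u0, u). psd (M_mat A a b \<beta> (z, l0, u0, u)) \<and> norm u \<le> - u0 \<and> l0 \<ge> 0}"

definition D_objective :: "real^'n^'n \<Rightarrow> real^'n \<Rightarrow> real^'n \<Rightarrow> real^'n^'n \<Rightarrow> real" where
  "D_objective A a x X = A \<bullet>\<bullet> X + 2 * (a \<bullet> x)"

definition D_feasible :: "real^'n \<Rightarrow> real \<Rightarrow> ((real^'n) \<times> (real^'n^'n)) set" where
  "D_feasible b \<beta> =
     {(x, X). transpose X = X \<and> trace X \<le> 1 \<and>
        norm (\<beta> *\<^sub>R x - X *v b) \<le> - (b \<bullet> x) + \<beta> \<and> psd (X - outer x x)}"

definition multipliers :: "'n::finite multiplier set" where
  "multipliers = {(\<alpha>, x, X, v0, vb). psd (bordered \<alpha> x X) \<and> norm vb \<le> v0}"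

definition Lagrangian ::
  "real^'n^'n \<Rightarrow> real^'n \<Rightarrow> real^'n \<Rightarrow> real \<Rightarrow> 'n primal \<Rightarrow> 'n multiplier \<Rightarrow> real" where
  "Lagrangian A a b \<beta> = (\<lambda>(z, l0, u0, u) (\<alpha>, x, X, v0, vb).
     z + M_mat A a b \<beta> (z, l0, u0, u) \<bullet>\<bullet> bordered \<alpha> x X + vb \<bullet> u - v0 * u0)"

text \<open>The dual function is the maximum of the Lagrangian over a set of primal variables. Over
  cone_domain, where the second-order cone constraint is kept although it
  has the multiplier v, the dual function is finite for more multipliers than those satisfying
  Xb - beta x + vb = 0. That equation is forced when only the consequence u0 \<le> 0 of
  the cone constraint is kept and u is free, as in halfspace_domain.\<close>

definition cone_domain :: "'n::finite primal set" where
  "cone_domain = {(z, l0, u0, u). l0 \<ge> 0 \<and> norm u \<le> - u0}"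

definition halfspace_domain :: "'n::finite primal set" where
  "halfspace_domain = {(z, l0, u0, u). l0 \<ge> 0 \<and> u0 \<le> 0}"

definition dual_function ::
  "'n primal set \<Rightarrow> real^'n^'n \<Rightarrow> real^'n \<Rightarrow> real^'n \<Rightarrow> real \<Rightarrow> 'n multiplier \<Rightarrow> ereal" where
  "dual_function \<Omega> A a b \<beta> y = (SUP p\<in>\<Omega>. ereal (Lagrangian A a b \<beta> p y))"

text \<open>The feasible set of the Lagrangian dual after elimination of alpha = 1.\<close>

definition reduced_feasible ::
  "real^'n \<Rightarrow> real \<Rightarrow> ((real^'n) \<times> (real^'n^'n) \<times> real \<times> (real^'n)) set" where
  "reduced_feasible b \<beta> =
     {(x, X, v0, vb). transpose X = X \<and> trace X - 1 \<le> 0 \<and> X *v b - \<beta> *\<^sub>R x + vb = 0 \<and>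
        - (b \<bullet> x) - v0 + \<beta> \<ge> 0 \<and> norm vb \<le> v0 \<and> psd (X - outer x x)}"

end

theory Submission
  imports Defs
begin

text \<open>The Lagrangian is affine in the primal variables, with coefficients 1 - alpha of z,
  trace X - alpha of l0, alpha beta - b^T x - v0 of u0 and Xb - beta x + vb of u. So over a cone it
  is maximal at the origin, or unbounded along a ray on which its linear part is positive. For the
  second-order cone this ray is (u0, u) = (-1, g / norm g) with g the coefficient of u. The
  triangle inequality applied to g and vb then shows that both domains project onto the
  feasible set of (D). Minimizing over the multipliers instead recovers (P), because the cone of
  positive semidefinite matrices is self-dual for the trace inner product.\<close>

subsection \<open>The trace inner product\<close>

lemma frob_eq_sum: "P \<bullet>\<bullet> Q = (\<Sum>i\<in>UNIV. \<Sum>j\<in>UNIV. P $ i $ j * Q $ i $ j)"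
  unfolding frob_def trace_def matrix_matrix_mult_def transpose_def
  by (simp, rule sum.swap)

lemma frob_add_left: "(P + Q) \<bullet>\<bullet> X = P \<bullet>\<bullet> X + Q \<bullet>\<bullet> X"
  by (simp add: frob_eq_sum distrib_right sum.distrib)

lemma frob_add_right: "X \<bullet>\<bullet> (P + Q) = X \<bullet>\<bullet> P + X \<bullet>\<bullet> Q"
  by (simp add: frob_eq_sum distrib_left sum.distrib)

lemma frob_scaleR_left: "(c *\<^sub>R P) \<bullet>\<bullet> X = c * (P \<bullet>\<bullet> X)"
  by (simp add: frob_eq_sum sum_distrib_left mult.assoc)

lemma frob_scaleR_right: "X \<bullet>\<bullet> (c *\<^sub>R P) = c * (X \<bullet>\<bullet> P)"
  by (simp add: frob_eq_sum sum_distrib_left mult_ac)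

lemma frob_mat_1: "mat 1 \<bullet>\<bullet> X = trace X"
  by (simp add: frob_def transpose_mat)

lemma frob_outer_left: "outer u v \<bullet>\<bullet> X = u \<bullet> (X *v v)"
  by (simp add: frob_eq_sum outer_def inner_vec_def matrix_vector_mult_def
      sum_distrib_left mult_ac)

lemma frob_outer_right: "X \<bullet>\<bullet> outer u v = u \<bullet> (X *v v)"
  by (simp add: frob_eq_sum outer_def inner_vec_def matrix_vector_mult_def
      sum_distrib_left mult_ac)

lemma inner_matrix_vector_symmetric:
  fixes S :: "real^'m^'m"
  assumes "transpose S = S"
  shows "v \<bullet> (S *v w) = w \<bullet> (S *v v)"
  by (metis assms dot_lmul_matrix inner_commute transpose_matrix_vector)

lemma outer_mult_vec: "outer u v *v w = (v \<bullet> w) *\<^sub>R u"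
  by (simp add: vec_eq_iff outer_def matrix_vector_mult_def inner_vec_def
      sum_distrib_left mult_ac)

lemma transpose_outer: "transpose (outer u v) = outer v u"
  by (simp add: vec_eq_iff transpose_def outer_def)

lemma transpose_add: "transpose (P + Q) = transpose P + transpose (Q :: real^'m^'k)"
  by (simp add: vec_eq_iff transpose_def)

lemma transpose_diff: "transpose (P - Q) = transpose P - transpose (Q :: real^'m^'k)"
  by (simp add: vec_eq_iff transpose_def)

lemma transpose_scaleR: "transpose (c *\<^sub>R P) = c *\<^sub>R transpose (P :: real^'m^'k)"
  by (simp add: vec_eq_iff transpose_def)

lemma scaleR_matrix_vector: "(c *\<^sub>R P) *v w = c *\<^sub>R (P *v (w :: real^'m))"
  by (simp add: vec_eq_iff matrix_vector_mult_def sum_distrib_left mult_ac)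

text \<open>These matrices form the rays of multipliers along which the Lagrangian detects a matrix
  that is not positive semidefinite.\<close>

lemma psd_scaled_outer:
  assumes "t \<ge> 0"
  shows "psd (t *\<^sub>R outer w w)"
proof -
  have "v \<bullet> ((t *\<^sub>R outer w w) *v v) = t * (v \<bullet> w)\<^sup>2" for v
    by (simp add: scaleR_matrix_vector outer_mult_vec inner_commute power2_eq_square)
  with assms show ?thesis
    by (simp add: psd_def transpose_scaleR transpose_outer)
qed

subsection \<open>Self-duality of the cone of positive semidefinite matrices\<close>

text \<open>Evaluated at \<open>s *\<^sub>R v + t *\<^sub>R w\<close>, the form is a nonnegative
  quadratic in (s, t), which bounds its discriminant. The form may be degenerate, so r = 0 is a case
  of its own.\<close>

lemma psd_Cauchy_Schwarz:
  fixes S :: "real^'m^'m"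
  assumes "psd S"
  shows "(v \<bullet> (S *v w))\<^sup>2 \<le> (v \<bullet> (S *v v)) * (w \<bullet> (S *v w))"
proof -
  define p q r where "p = v \<bullet> (S *v v)" and "q = v \<bullet> (S *v w)" and "r = w \<bullet> (S *v w)"
  have sym: "w \<bullet> (S *v v) = q"
    using assms inner_matrix_vector_symmetric[of S w v] by (simp add: psd_def q_def)
  have nonneg: "0 \<le> s\<^sup>2 * p + 2 * s * t * q + t\<^sup>2 * r" for s t
  proof -
    have "0 \<le> (s *\<^sub>R v + t *\<^sub>R w) \<bullet> (S *v (s *\<^sub>R v + t *\<^sub>R w))"
      using assms by (simp add: psd_def)
    also have "\<dots> = s\<^sup>2 * p + 2 * s * t * q + t\<^sup>2 * r"
      using sym
      by (simp add: matrix_vector_right_distrib matrix_vector_mult_scaleR inner_add_left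
          inner_add_right p_def q_def r_def power2_eq_square algebra_simps)
    finally show ?thesis .
  qed
  have "q\<^sup>2 \<le> p * r"
  proof (cases "r = 0")
    case True
    have "q = 0"
    proof (rule ccontr)
      assume "q \<noteq> 0"
      \<comment> \<open>For r = 0 and s = 1 the quadratic is p + 2 t q, which takes the value -1 at
        this t.\<close>
      with nonneg[of 1 "- (p + 1) / (2 * q)"] nonneg[of 1 0] True show False
        by (simp add: field_simps)
    qed
    with True show ?thesis by simp
  next
    case False
    with nonneg[of 0 1] have "r > 0" by simp
    \<comment> \<open>The minimizer in t at s = 1 is t = -q / r; scaling by r gives (s, t) = (r,
      -q).\<close>
    moreover have "0 \<le> r * (p * r - q\<^sup>2)"
      using nonneg[of r "- q"] by (simp add: power2_eq_square algebra_simps)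
    ultimately show ?thesis by (simp add: zero_le_mult_iff)
  qed
  then show ?thesis by (simp add: p_def q_def r_def)
qed

lemma inner_axis_one: "v \<bullet> axis i 1 = (v :: real^'m) $ i"
  by (simp add: inner_axis)

lemma matrix_entry: "axis i 1 \<bullet> (S *v axis j 1) = (S :: real^'m^'m) $ i $ j"
  by (simp add: inner_axis' matrix_vector_mul_component inner_axis)

text \<open>Cauchy-Schwarz for two coordinate vectors bounds the square of the entry (i, j) by the
  product of the diagonal entries at i and j.\<close>

lemma psd_zero_diagonal_row:
  fixes S :: "real^'m^'m"
  assumes "psd S" "S $ i $ i = 0"
  shows "S $ i $ j = 0"
  using psd_Cauchy_Schwarz[OF assms(1), of "axis i 1" "axis j 1"] assms(2)
  by (simp add: matrix_entry)

text \<open>One step of the Cholesky factorization splits off a rank-one term and clears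
  a nonzero diagonal entry of the second factor.\<close>

lemma frob_psd_nonneg:
  fixes S Y :: "real^'m^'m"
  assumes "psd S" "psd Y"
  shows "0 \<le> S \<bullet>\<bullet> Y"
  using assms(2)
\<comment> \<open>Each step lowers the number of nonzero diagonal entries. When none is left, all
  rows vanish and the product is 0.\<close>
proof (induction "card {i. Y $ i $ i \<noteq> 0}" arbitrary: Y rule: less_induct)
  case less
  show ?case
  proof (cases "\<forall>i. Y $ i $ i = 0")
    case True
    then show ?thesis
      using psd_zero_diagonal_row[OF less.prems] by (simp add: frob_eq_sum)
  next
    case False
    then obtain k where k: "Y $ k $ k \<noteq> 0" by blast
    define d y where "d = Y $ k $ k" and "y = Y *v axis k 1"
    have diag: "0 \<le> Y $ i $ i" for i
      using less.prems unfolding psd_def by (metis matrix_entry)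
    have d: "d > 0"
      using k diag[of k] by (simp add: d_def)
    \<comment> \<open>Since \<open>y\<close> is column \<open>k\<close> of \<open>Y\<close>, the
      matrix \<open>Z\<close> is the Schur complement of the pivot \<open>d\<close>, padded by a
      zero row and column.\<close>
    define Z where "Z = Y - (1 / d) *\<^sub>R outer y y"
    have y_entry: "y $ i = Y $ i $ k" for i
      by (metis inner_axis_one inner_commute matrix_entry y_def)
    \<comment> \<open>This is exactly the bound under which subtracting the rank-one term keeps the
      form nonnegative.\<close>
    have wy: "(w \<bullet> y)\<^sup>2 \<le> (w \<bullet> (Y *v w)) * d" for w
      using psd_Cauchy_Schwarz[OF less.prems, of w "axis k 1"]
      by (simp add: matrix_entry d_def y_def)
    have "psd Z"
      unfolding psd_def
    proof (intro conjI allI)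
      show "transpose Z = Z"
        using less.prems
        by (simp add: Z_def psd_def transpose_diff transpose_scaleR transpose_outer)
      fix w
      have "w \<bullet> (Z *v w) = w \<bullet> (Y *v w) - (w \<bullet> y)\<^sup>2 / d"
        by (simp add: Z_def matrix_vector_mult_diff_rdistrib scaleR_matrix_vector outer_mult_vec
            inner_diff_right inner_commute power2_eq_square)
      then show "0 \<le> w \<bullet> (Z *v w)"
        using wy[of w] d by (simp add: pos_divide_le_eq)
    qed
    have Z_diag: "Z $ i $ i = Y $ i $ i - (Y $ i $ k)\<^sup>2 / d" for i
      by (simp add: Z_def outer_def y_entry power2_eq_square)
    have "{i. Z $ i $ i \<noteq> 0} \<subset> {i. Y $ i $ i \<noteq> 0}"
    proof
      \<comment> \<open>Where the diagonal of \<open>Y\<close> is 0 its whole row is 0, including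
        the entry in column \<open>k\<close>, so nothing is subtracted there.\<close>
      show "{i. Z $ i $ i \<noteq> 0} \<subseteq> {i. Y $ i $ i \<noteq> 0}"
        using psd_zero_diagonal_row[OF less.prems] by (auto simp: Z_diag)
      have "Z $ k $ k = 0"
        using d by (simp add: Z_diag d_def power2_eq_square)
      then show "{i. Z $ i $ i \<noteq> 0} \<noteq> {i. Y $ i $ i \<noteq> 0}"
        using k by blast
    qed
    then have "card {i. Z $ i $ i \<noteq> 0} < card {i. Y $ i $ i \<noteq> 0}"
      by (simp add: psubset_card_mono)
    then have "0 \<le> S \<bullet>\<bullet> Z"
      using less.hyps \<open>psd Z\<close> by blast
    moreover have "S \<bullet>\<bullet> Y = S \<bullet>\<bullet> Z + (y \<bullet> (S *v y)) / d"
      using frob_add_right[of S Z "(1 / d) *\<^sub>R outer y y"]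
      by (simp add: Z_def frob_scaleR_right frob_outer_right)
    moreover have "0 \<le> y \<bullet> (S *v y)"
      using assms(1) by (simp add: psd_def)
    ultimately show ?thesis using d by simp
  qed
qed

subsection \<open>Bordered matrices\<close>

lemma sum_UNIV_option:
  fixes f :: "'m::finite option \<Rightarrow> 'b::comm_monoid_add"
  shows "sum f UNIV = f None + (\<Sum>i\<in>UNIV. f (Some i))"
  by (simp add: UNIV_option_conv sum.reindex)

lemma frob_bordered:
  "bordered s w S \<bullet>\<bullet> bordered \<alpha> x X = s * \<alpha> + 2 * (w \<bullet> x) + S \<bullet>\<bullet> X"
  by (simp add: frob_eq_sum sum_UNIV_option bordered_def sum.distrib inner_vec_def)

lemma transpose_bordered: "transpose (bordered s w S) = bordered s w (transpose S)"
  by (simp add: vec_eq_iff transpose_def bordered_def split: option.split)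

lemma bordered_inject:
  "bordered s w S = bordered s' w' S' \<longleftrightarrow> s = s' \<and> w = w' \<and> S = S'"
  by (auto simp: vec_eq_iff bordered_def split_option_all split: option.split)

lemma bordered_zero: "bordered 0 0 0 = 0"
  by (simp add: vec_eq_iff bordered_def split: option.split)

lemma bordered_quadratic_form:
  "y \<bullet> (bordered s w S *v y) =
     s * (y $ None)\<^sup>2 + 2 * y $ None * (w \<bullet> (\<chi> i. y $ Some i))
       + (\<chi> i. y $ Some i) \<bullet> (S *v (\<chi> i. y $ Some i))"
  by (simp add: inner_vec_def matrix_vector_mult_def sum_UNIV_option bordered_def
      sum.distrib sum_distrib_left power2_eq_square algebra_simps)

text \<open>This reads off the blocks \<alpha>, x and X of a rank-one matrix, so that it can serve
  as a multiplier.\<close>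

lemma outer_option_bordered:
  "t *\<^sub>R outer y y =
     bordered (t * (y $ None)\<^sup>2) ((t * y $ None) *\<^sub>R (\<chi> i. y $ Some i))
       (t *\<^sub>R outer (\<chi> i. y $ Some i) (\<chi> i. y $ Some i))"
  by (simp add: vec_eq_iff bordered_def outer_def power2_eq_square split: option.split)

lemma psd_bordered_symmetric:
  assumes "psd (bordered \<alpha> x X)"
  shows "transpose X = X"
  using assms by (simp add: psd_def transpose_bordered bordered_inject)

text \<open>Completing the square in the coordinate \<open>None\<close> leaves the form of the Schur
  complement \<open>X - outer x x\<close>.\<close>

lemma psd_bordered_one_iff:
  "psd (bordered 1 x X) \<longleftrightarrow> transpose X = X \<and> psd (X - outer x x)"
proof -
  have schur: "y \<bullet> (bordered 1 x X *v y) =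
      (y $ None + x \<bullet> (\<chi> i. y $ Some i))\<^sup>2
        + (\<chi> i. y $ Some i) \<bullet> ((X - outer x x) *v (\<chi> i. y $ Some i))" for y
    unfolding bordered_quadratic_form
    by (simp add: matrix_vector_mult_diff_rdistrib outer_mult_vec inner_diff_right
        inner_commute power2_eq_square algebra_simps)
  have "0 \<le> w \<bullet> ((X - outer x x) *v w)" if nn: "\<forall>y. 0 \<le> y \<bullet> (bordered 1 x X *v y)" for w
  proof -
    \<comment> \<open>The entry at \<open>None\<close> is chosen so that the completed square
      vanishes.\<close>
    define y :: "real^('a option)"
      where "y = (\<chi> i. case i of None \<Rightarrow> - (x \<bullet> w) | Some k \<Rightarrow> w $ k)"
    have "y $ None = - (x \<bullet> w)" "(\<chi> i. y $ Some i) = w"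
      by (simp_all add: y_def)
    with schur[of y] nn show ?thesis by (metis add.left_inverse add_0 zero_power2)
  qed
  moreover have "0 \<le> y \<bullet> (bordered 1 x X *v y)"
    if "\<forall>w. 0 \<le> w \<bullet> ((X - outer x x) *v w)" for y
    using that by (simp add: schur)
  ultimately show ?thesis
    by (auto simp: psd_def transpose_bordered bordered_inject transpose_diff transpose_outer)
qed

subsection \<open>The Lagrangian\<close>

text \<open>As X is symmetric, the two halves of b u^T + u b^T pair equally with it, which gives the
  coefficient Xb of u.\<close>

lemma Lagrangian_collected:
  assumes "transpose X = X"
  shows "Lagrangian A a b \<beta> (z, l0, u0, u) (\<alpha>, x, X, v0, vb) =
    A \<bullet>\<bullet> X + 2 * (a \<bullet> x) + z * (1 - \<alpha>) + l0 * (trace X - \<alpha>)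
      + u0 * (\<alpha> * \<beta> - b \<bullet> x - v0) + u \<bullet> (X *v b - \<beta> *\<^sub>R x + vb)"
  using inner_matrix_vector_symmetric[OF assms, of b u]
  by (simp add: Lagrangian_def M_mat_def frob_bordered frob_add_left frob_scaleR_left
      frob_mat_1 frob_outer_left inner_simps algebra_simps inner_commute)

section \<open>Unboundedness along rays\<close>

text \<open>A function that grows with slope k > 0 along a ray inside the domain exceeds every
  bound. This yields all infinite values of the dual function.\<close>

lemma SUP_ray_eq_infinity:
  fixes L :: "'p \<Rightarrow> real"
  assumes "k > 0" "\<And>t. t \<ge> 0 \<Longrightarrow> r t \<in> \<Omega>" "\<And>t. t \<ge> 0 \<Longrightarrow> L (r t) = c + t * k"
  shows "(SUP p\<in>\<Omega>. ereal (L p)) = \<infinity>"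
proof (rule SUP_PInfty)
  fix n :: nat
  \<comment> \<open>At this t the gain over c is the distance from c to n.\<close>
  define t where "t = \<bar>real n - c\<bar> / k"
  have t: "t \<ge> 0" and "t * k = \<bar>real n - c\<bar>"
    using assms(1) by (simp_all add: t_def)
  with assms(3)[OF t] have "real n \<le> L (r t)" by linarith
  with assms(2)[OF t] show "\<exists>p\<in>\<Omega>. ereal (real n) \<le> ereal (L p)"
    by auto
qed

lemma INF_ray_eq_minus_infinity:
  fixes L :: "'p \<Rightarrow> real"
  assumes "k < 0" "\<And>t. t \<ge> 0 \<Longrightarrow> r t \<in> \<Omega>" "\<And>t. t \<ge> 0 \<Longrightarrow> L (r t) = c + t * k"
  shows "(INF p\<in>\<Omega>. ereal (L p)) = - \<infinity>"
proof -
  have "(SUP p\<in>\<Omega>. ereal (- L p)) = \<infinity>"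
    by (rule SUP_ray_eq_infinity[where k = "- k" and r = r and c = "- c"]) (use assms in auto)
  then show ?thesis
    using ereal_SUP_uminus_eq[of "\<lambda>p. ereal (L p)" \<Omega>]
    by (metis (no_types, lifting) SUP_cong ereal_uminus_uminus uminus_ereal.simps(1))
qed

section \<open>Minimizing over the multipliers\<close>

text \<open>Both cones are self-dual: at a feasible point the multiplier terms are nonnegative, and
  a violated cone constraint gives a ray of multipliers along which the Lagrangian decreases. The
  constraint on \<open>l0\<close> has no multiplier and so is a hypothesis.\<close>

lemma INF_Lagrangian:
  fixes A :: "real^'n^'n"
  assumes "transpose A = A" "l0 \<ge> 0"
  shows "(INF y\<in>multipliers. ereal (Lagrangian A a b \<beta> (z, l0, u0, u) y)) =
    (if (z, l0, u0, u) \<in> P_feasible A a b \<beta> then ereal z else -\<infinity>)"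
proof -
  let ?M = "M_mat A a b \<beta> (z, l0, u0, u)"
  let ?L = "Lagrangian A a b \<beta> (z, l0, u0, u)"
  have psd_0: "psd (0 :: real^('n option)^('n option))"
    by (simp add: psd_def vec_eq_iff transpose_def)
  have M_sym: "transpose ?M = ?M"
    using assms(1)
    by (simp add: M_mat_def transpose_bordered transpose_add transpose_scaleR transpose_outer
        transpose_mat add.commute)
  consider (feasible) "psd ?M" "norm u \<le> - u0" | (not_psd) "\<not> psd ?M" | (not_cone) "- u0 < norm u"
    by fastforce
  then show ?thesis
  proof cases
    case feasible
    have "z \<le> ?L y" if y: "y \<in> multipliers" for y
    proof -
      obtain \<alpha> x X v0 vb where y_eq: "y = (\<alpha>, x, X, v0, vb)" by (cases y)
      with y have psd: "psd (bordered \<alpha> x X)" and v: "norm vb \<le> v0"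
        by (auto simp: multipliers_def)
      \<comment> \<open>The pairing of (v0, vb) with (-u0, u) is nonnegative, as both lie in the
        second-order cone.\<close>
      have "- (vb \<bullet> u) \<le> norm vb * norm u"
        using Cauchy_Schwarz_ineq2[of vb u] by linarith
      also have "\<dots> \<le> v0 * (- u0)"
        using v feasible(2) order_trans[OF norm_ge_zero v] by (intro mult_mono) auto
      finally show ?thesis
        using frob_psd_nonneg[OF feasible(1) psd] by (simp add: y_eq Lagrangian_def)
    qed
    \<comment> \<open>The zero multiplier attains the lower bound z.\<close>
    moreover have "(0, 0, 0, 0, 0) \<in> (multipliers :: 'n multiplier set)" "?L (0, 0, 0, 0, 0) = z"
      using psd_0 by (simp_all add: multipliers_def Lagrangian_def bordered_zero frob_eq_sum)
    ultimately have "(INF y\<in>multipliers. ereal (?L y)) = ereal z"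
      by (intro antisym INF_greatest) (auto intro: INF_lower2)
    with feasible assms(2) show ?thesis by (simp add: P_feasible_def)
  next
    case not_psd
    \<comment> \<open>The matrix is symmetric, so its form must be negative at some w; the ray of
      multipliers is then t w w^T.\<close>
    with M_sym obtain w where w: "w \<bullet> (?M *v w) < 0"
      by (auto simp: psd_def not_le)
    let ?r = "\<lambda>t. (t * (w $ None)\<^sup>2, (t * w $ None) *\<^sub>R (\<chi> i. w $ Some i),
        t *\<^sub>R outer (\<chi> i. w $ Some i) (\<chi> i. w $ Some i), 0 :: real, 0 :: real^'n)"
    have "(INF y\<in>multipliers. ereal (?L y)) = - \<infinity>"
    proof (rule INF_ray_eq_minus_infinity[OF w, where r = ?r and c = z])
      fix t :: real
      assume "t \<ge> 0"
      then show "?r t \<in> multipliers"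
        using psd_scaled_outer[of t w] by (simp add: multipliers_def outer_option_bordered)
      show "?L (?r t) = z + t * (w \<bullet> (?M *v w))"
        by (simp add: Lagrangian_def outer_option_bordered[symmetric] frob_scaleR_right
            frob_outer_right)
    qed
    with not_psd show ?thesis by (simp add: P_feasible_def)
  next
    case not_cone
    \<comment> \<open>The vector part points against u, the worst direction in the cone. The
      convention \<open>sgn 0 = 0\<close> covers u = 0.\<close>
    let ?r = "\<lambda>t. (0 :: real, 0 :: real^'n, 0 :: real^'n^'n, t, - (t *\<^sub>R sgn u))"
    have "(INF y\<in>multipliers. ereal (?L y)) = - \<infinity>"
    proof (rule INF_ray_eq_minus_infinity[where k = "- u0 - norm u" and r = ?r and c = z])
      show "- u0 - norm u < 0"
        using not_cone by simp
      fix t :: real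
      assume t: "t \<ge> 0"
      then show "?r t \<in> multipliers"
        using psd_0 by (simp add: multipliers_def bordered_zero norm_sgn)
      have "sgn u \<bullet> u = norm u"
        by (cases "u = 0") (simp_all add: sgn_div_norm dot_square_norm power2_eq_square)
      then show "?L (?r t) = z + t * (- u0 - norm u)"
        by (simp add: Lagrangian_def bordered_zero frob_eq_sum algebra_simps)
    qed
    with not_cone show ?thesis by (simp add: P_feasible_def)
  qed
qed

section \<open>Maximizing over the primal variables\<close>

text \<open>The variable z is free and \<open>l0\<close> is only bounded below, so the coefficient
  of z must vanish and that of \<open>l0\<close> must not be positive. Both domains contain these
  rays.\<close>

lemma dual_function_eq_infinity_z_l0:
  assumes "transpose X = X" "\<alpha> \<noteq> 1 \<or> trace X > \<alpha>"
    and dom: "\<And>z l0. l0 \<ge> 0 \<Longrightarrow> (z, l0, 0, 0) \<in> \<Omega>"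
  shows "dual_function \<Omega> A a b \<beta> (\<alpha>, x, X, v0, vb) = \<infinity>"
proof -
  consider (z) "\<alpha> \<noteq> 1" | (l0) "trace X > \<alpha>" using assms(2) by blast
  then show ?thesis
    unfolding dual_function_def
  proof cases
    case z
    show "(SUP p\<in>\<Omega>. ereal (Lagrangian A a b \<beta> p (\<alpha>, x, X, v0, vb))) = \<infinity>"
      \<comment> \<open>Moving z in proportion to its coefficient makes the slope a square, whatever
        the sign of 1 - \<alpha>.\<close>
      by (rule SUP_ray_eq_infinity[where k = "(1 - \<alpha>)\<^sup>2" and r = "\<lambda>t. (t * (1 - \<alpha>), 0, 0, 0)"
            and c = "A \<bullet>\<bullet> X + 2 * (a \<bullet> x)"])
        (use z in \<open>simp_all add: Lagrangian_collected[OF assms(1)] dom flip: power2_eq_square\<close>)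
  next
    case l0
    show "(SUP p\<in>\<Omega>. ereal (Lagrangian A a b \<beta> p (\<alpha>, x, X, v0, vb))) = \<infinity>"
      by (rule SUP_ray_eq_infinity[where k = "trace X - \<alpha>" and r = "\<lambda>t. (0, t, 0, 0)"
            and c = "A \<bullet>\<bullet> X + 2 * (a \<bullet> x)"])
        (use l0 in \<open>auto simp: Lagrangian_collected[OF assms(1)] intro: dom\<close>)
  qed
qed

text \<open>The two domains differ only in the directions (s, w) of (u0, u) that they contain, so
  the direction is a parameter.\<close>

lemma dual_function_eq_infinity_u:
  assumes "transpose X = X" "\<alpha> = 1"
    and "s * (\<beta> - b \<bullet> x - v0) + w \<bullet> (X *v b - \<beta> *\<^sub>R x + vb) > 0"
    and dom: "\<And>t. t \<ge> 0 \<Longrightarrow> (0, 0, t * s, t *\<^sub>R w) \<in> \<Omega>"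
  shows "dual_function \<Omega> A a b \<beta> (\<alpha>, x, X, v0, vb) = \<infinity>"
  unfolding dual_function_def
  by (rule SUP_ray_eq_infinity[OF assms(3), where r = "\<lambda>t. (0, 0, t * s, t *\<^sub>R w)"
        and c = "A \<bullet>\<bullet> X + 2 * (a \<bullet> x)"])
    (use assms(2) in \<open>auto simp: Lagrangian_collected[OF assms(1)] algebra_simps intro: dom\<close>)

text \<open>Under these conditions the linear part of the Lagrangian is at most 0 on the domain, so
  the origin is a maximizer.\<close>

lemma dual_function_eq_objective:
  assumes "transpose X = X" "\<alpha> = 1" "trace X \<le> \<alpha>" "(0, 0, 0, 0) \<in> \<Omega>"
    and l0: "\<And>z l0 u0 u. (z, l0, u0, u) \<in> \<Omega> \<Longrightarrow> l0 \<ge> 0"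
    and u: "\<And>z l0 u0 u. (z, l0, u0, u) \<in> \<Omega> \<Longrightarrow>
      u0 * (\<beta> - b \<bullet> x - v0) + u \<bullet> (X *v b - \<beta> *\<^sub>R x + vb) \<le> 0"
  shows "dual_function \<Omega> A a b \<beta> (\<alpha>, x, X, v0, vb) = ereal (A \<bullet>\<bullet> X + 2 * (a \<bullet> x))"
  unfolding dual_function_def
proof (intro antisym SUP_least)
  fix p assume "p \<in> \<Omega>"
  moreover obtain z l0 u0 u where p: "p = (z, l0, u0, u)" by (cases p)
  ultimately have "l0 * (trace X - \<alpha>) \<le> 0"
    using l0 assms(3) by (auto simp: mult_nonneg_nonpos)
  moreover have "u0 * (\<beta> - b \<bullet> x - v0) + u \<bullet> (X *v b - \<beta> *\<^sub>R x + vb) \<le> 0"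
    using u \<open>p \<in> \<Omega>\<close> p by blast
  ultimately show "ereal (Lagrangian A a b \<beta> p (\<alpha>, x, X, v0, vb)) \<le>
      ereal (A \<bullet>\<bullet> X + 2 * (a \<bullet> x))"
    unfolding p Lagrangian_collected[OF assms(1)] using assms(2) by simp
next
  have "Lagrangian A a b \<beta> (0, 0, 0, 0) (\<alpha>, x, X, v0, vb) = A \<bullet>\<bullet> X + 2 * (a \<bullet> x)"
    by (simp add: Lagrangian_collected[OF assms(1)])
  then show "ereal (A \<bullet>\<bullet> X + 2 * (a \<bullet> x)) \<le>
      (SUP p\<in>\<Omega>. ereal (Lagrangian A a b \<beta> p (\<alpha>, x, X, v0, vb)))"
    using SUP_upper[OF assms(4), of "\<lambda>p. ereal (Lagrangian A a b \<beta> p (\<alpha>, x, X, v0, vb))"]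
    by simp
qed

text \<open>Here u is free, so its coefficient must vanish; u0 ranges over a half-line, so only the
  sign of its coefficient matters.\<close>

lemma dual_function_halfspace:
  assumes "transpose X = X"
  shows "dual_function halfspace_domain A a b \<beta> (\<alpha>, x, X, v0, vb) =
    (if 1 - \<alpha> = 0 \<and> trace X - \<alpha> \<le> 0 \<and> X *v b - \<beta> *\<^sub>R x + vb = 0 \<and>
        - (b \<bullet> x) - v0 + \<beta> \<ge> 0
     then ereal (A \<bullet>\<bullet> X + 2 * (a \<bullet> x)) else \<infinity>)"
proof -
  let ?g = "X *v b - \<beta> *\<^sub>R x + vb"
  consider (z_l0) "\<alpha> \<noteq> 1 \<or> trace X > \<alpha>" | (u) "\<alpha> = 1" "?g \<noteq> 0"
    | (u0) "\<alpha> = 1" "\<beta> - b \<bullet> x - v0 < 0"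
    | (finite) "\<alpha> = 1" "trace X \<le> \<alpha>" "?g = 0" "\<beta> - b \<bullet> x - v0 \<ge> 0"
    by linarith
  then show ?thesis
  proof cases
    case z_l0
    then have "dual_function halfspace_domain A a b \<beta> (\<alpha>, x, X, v0, vb) = \<infinity>"
      by (intro dual_function_eq_infinity_z_l0 assms) (auto simp: halfspace_domain_def)
    with z_l0 show ?thesis by auto
  next
    case u
    then have "dual_function halfspace_domain A a b \<beta> (\<alpha>, x, X, v0, vb) = \<infinity>"
      \<comment> \<open>Along its own coefficient, u yields the slope
        \<open>?g \<bullet> ?g\<close>.\<close>
      by (intro dual_function_eq_infinity_u[where s = 0 and w = ?g] assms)
        (auto simp: halfspace_domain_def)
    with u show ?thesis by auto
  next
    case u0
    then have "dual_function halfspace_domain A a b \<beta> (\<alpha>, x, X, v0, vb) = \<infinity>"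
      by (intro dual_function_eq_infinity_u[where s = "-1" and w = 0] assms)
        (auto simp: halfspace_domain_def)
    with u0 show ?thesis by auto
  next
    case finite
    then have "dual_function halfspace_domain A a b \<beta> (\<alpha>, x, X, v0, vb) =
        ereal (A \<bullet>\<bullet> X + 2 * (a \<bullet> x))"
      by (intro dual_function_eq_objective assms)
        (auto simp: halfspace_domain_def mult_nonpos_nonneg)
    with finite show ?thesis by auto
  qed
qed

text \<open>The norm condition says that the coefficients of (u0, u) pair nonpositively with every
  point of the cone, by its self-duality.\<close>

lemma dual_function_cone:
  assumes "transpose X = X"
  shows "dual_function cone_domain A a b \<beta> (\<alpha>, x, X, v0, vb) =
    (if 1 - \<alpha> = 0 \<and> trace X - \<alpha> \<le> 0 \<and>
        norm (X *v b - \<beta> *\<^sub>R x + vb) \<le> - (b \<bullet> x) - v0 + \<beta>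
     then ereal (A \<bullet>\<bullet> X + 2 * (a \<bullet> x)) else \<infinity>)"
proof -
  let ?g = "X *v b - \<beta> *\<^sub>R x + vb"
  consider (z_l0) "\<alpha> \<noteq> 1 \<or> trace X > \<alpha>" | (u) "\<alpha> = 1" "norm ?g > \<beta> - b \<bullet> x - v0"
    | (finite) "\<alpha> = 1" "trace X \<le> \<alpha>" "norm ?g \<le> \<beta> - b \<bullet> x - v0"
    by linarith
  then show ?thesis
  proof cases
    case z_l0
    then have "dual_function cone_domain A a b \<beta> (\<alpha>, x, X, v0, vb) = \<infinity>"
      by (intro dual_function_eq_infinity_z_l0 assms) (auto simp: cone_domain_def)
    with z_l0 show ?thesis by auto
  next
    case u
    have "sgn ?g \<bullet> ?g = norm ?g"
      by (cases "?g = 0") (simp_all add: sgn_div_norm dot_square_norm power2_eq_square)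
    with u have "dual_function cone_domain A a b \<beta> (\<alpha>, x, X, v0, vb) = \<infinity>"
      \<comment> \<open>The slope is the excess of \<open>norm ?g\<close> over its bound; the
        direction stays in the cone since \<open>sgn ?g\<close> has norm at most 1.\<close>
      by (intro dual_function_eq_infinity_u[where s = "-1" and w = "sgn ?g"] assms)
        (auto simp: cone_domain_def norm_sgn)
    with u show ?thesis by auto
  next
    case finite
    have "u0 * (\<beta> - b \<bullet> x - v0) + u \<bullet> ?g \<le> 0" if "norm u \<le> - u0" for u0 u
    proof -
      have "u \<bullet> ?g \<le> norm u * norm ?g"
        by (rule norm_cauchy_schwarz)
      also have "\<dots> \<le> - u0 * (\<beta> - b \<bullet> x - v0)"
        using that finite(3) order_trans[OF norm_ge_zero that] by (intro mult_mono) auto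
      finally show ?thesis by simp
    qed
    with finite have "dual_function cone_domain A a b \<beta> (\<alpha>, x, X, v0, vb) =
        ereal (A \<bullet>\<bullet> X + 2 * (a \<bullet> x))"
      by (intro dual_function_eq_objective assms) (auto simp: cone_domain_def)
    with finite show ?thesis by auto
  qed
qed

subsection \<open>The dual problem\<close>

lemma multipliers_one_iff:
  "(1, x, X, v0, vb) \<in> multipliers \<longleftrightarrow>
    transpose X = X \<and> psd (X - outer x x) \<and> norm vb \<le> v0"
  by (simp add: multipliers_def psd_bordered_one_iff)

text \<open>Finiteness forces \<alpha> = 1, and the Schur complement then replaces the condition on
  Y by one on X. The symmetry of X comes from that of Y.\<close>

lemma finite_halfspace_dual_iff:
  "(\<alpha>, x, X, v0, vb) \<in> multipliers \<and>
     dual_function halfspace_domain A a b \<beta> (\<alpha>, x, X, v0, vb) < \<infinity> \<longleftrightarrow>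
   \<alpha> = 1 \<and> (x, X, v0, vb) \<in> reduced_feasible b \<beta>"
proof (cases "(\<alpha>, x, X, v0, vb) \<in> multipliers")
  case True
  then have "transpose X = X"
    using psd_bordered_symmetric by (auto simp: multipliers_def)
  with True show ?thesis
    by (auto simp: dual_function_halfspace multipliers_one_iff reduced_feasible_def)
next
  case False
  then show ?thesis by (auto simp: multipliers_one_iff reduced_feasible_def)
qed

lemma finite_cone_dual_iff:
  "(\<alpha>, x, X, v0, vb) \<in> multipliers \<and>
     dual_function cone_domain A a b \<beta> (\<alpha>, x, X, v0, vb) < \<infinity> \<longleftrightarrow>
   \<alpha> = 1 \<and> transpose X = X \<and> trace X \<le> 1 \<and> psd (X - outer x x) \<and> norm vb \<le> v0 \<and>
     norm (X *v b - \<beta> *\<^sub>R x + vb) \<le> - (b \<bullet> x) - v0 + \<beta>"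
proof (cases "(\<alpha>, x, X, v0, vb) \<in> multipliers")
  case True
  then have "transpose X = X"
    using psd_bordered_symmetric by (auto simp: multipliers_def)
  with True show ?thesis
    by (auto simp: dual_function_cone multipliers_one_iff)
next
  case False
  then show ?thesis by (auto simp: multipliers_one_iff)
qed

text \<open>The equation determines \<open>vb\<close>, and a suitable \<open>v0\<close> between
  \<open>norm vb\<close> and \<beta> - b^T x exists exactly when the norm constraint of (D)
  holds.\<close>

lemma reduced_feasible_projection:
  "(\<exists>v0 vb. (x, X, v0, vb) \<in> reduced_feasible b \<beta>) \<longleftrightarrow> (x, X) \<in> D_feasible b \<beta>"
proof
  assume "\<exists>v0 vb. (x, X, v0, vb) \<in> reduced_feasible b \<beta>"
  then obtain v0 vb where feasible: "(x, X, v0, vb) \<in> reduced_feasible b \<beta>" by blast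
  then have "X *v b - \<beta> *\<^sub>R x + vb = 0"
    by (simp add: reduced_feasible_def)
  then have "vb = \<beta> *\<^sub>R x - X *v b" by (simp add: algebra_simps eq_neg_iff_add_eq_0)
  with feasible show "(x, X) \<in> D_feasible b \<beta>"
    by (auto simp: reduced_feasible_def D_feasible_def)
next
  assume "(x, X) \<in> D_feasible b \<beta>"
  \<comment> \<open>The smallest admissible \<open>v0\<close> is taken.\<close>
  then have "(x, X, norm (\<beta> *\<^sub>R x - X *v b), \<beta> *\<^sub>R x - X *v b) \<in> reduced_feasible b \<beta>"
    by (auto simp: reduced_feasible_def D_feasible_def)
  then show "\<exists>v0 vb. (x, X, v0, vb) \<in> reduced_feasible b \<beta>" by blast
qed

text \<open>The vector \<beta> x - Xb is the difference of \<open>vb\<close> and the coefficient of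
  u. Adding the bounds on their norms cancels \<open>v0\<close>.\<close>

lemma cone_dual_projection:
  "(\<exists>\<alpha> v0 vb. (\<alpha>, x, X, v0, vb) \<in> multipliers \<and>
      dual_function cone_domain A a b \<beta> (\<alpha>, x, X, v0, vb) < \<infinity>) \<longleftrightarrow> (x, X) \<in> D_feasible b \<beta>"
    (is "?lhs \<longleftrightarrow> _")
proof
  assume ?lhs
  then obtain v0 vb where X: "transpose X = X" "trace X \<le> 1" "psd (X - outer x x)"
    and v: "norm vb \<le> v0" "norm (X *v b - \<beta> *\<^sub>R x + vb) \<le> - (b \<bullet> x) - v0 + \<beta>"
    unfolding finite_cone_dual_iff by blast
  have "norm (\<beta> *\<^sub>R x - X *v b) \<le> norm vb + norm (X *v b - \<beta> *\<^sub>R x + vb)"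
    using norm_triangle_ineq4[of vb "X *v b - \<beta> *\<^sub>R x + vb"] by simp
  with X v show "(x, X) \<in> D_feasible b \<beta>"
    by (simp add: D_feasible_def)
next
  assume "(x, X) \<in> D_feasible b \<beta>"
  \<comment> \<open>With v = 0 the finiteness condition is the norm constraint of (D)
    itself.\<close>
  then have "(1, x, X, 0, 0) \<in> multipliers \<and>
      dual_function cone_domain A a b \<beta> (1, x, X, 0, 0) < \<infinity>"
    unfolding finite_cone_dual_iff by (simp add: D_feasible_def norm_minus_commute)
  then show ?lhs by blast
qed

section \<open>Equality of the optimal values\<close>

text \<open>The objective does not depend on (v0, vb), so the infimum survives the
  projection.\<close>

lemma INF_reduced_eq_INF_D:
  "(INF (x, X, v0, vb)\<in>reduced_feasible b \<beta>. ereal (D_objective A a x X)) =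
    (INF (x, X)\<in>D_feasible b \<beta>. ereal (D_objective A a x X))"
proof (rule antisym)
  show "(INF (x, X, v0, vb)\<in>reduced_feasible b \<beta>. ereal (D_objective A a x X)) \<le>
      (INF (x, X)\<in>D_feasible b \<beta>. ereal (D_objective A a x X))"
  proof (rule INF_mono, clarify)
    fix x X
    assume "(x, X) \<in> D_feasible b \<beta>"
    then obtain v0 vb where "(x, X, v0, vb) \<in> reduced_feasible b \<beta>"
      using reduced_feasible_projection by blast
    then show "\<exists>y\<in>reduced_feasible b \<beta>.
        (case y of (x, X, v0, vb) \<Rightarrow> ereal (D_objective A a x X)) \<le> ereal (D_objective A a x X)"
      by (intro bexI) auto
  qed
next
  show "(INF (x, X)\<in>D_feasible b \<beta>. ereal (D_objective A a x X)) \<le>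
      (INF (x, X, v0, vb)\<in>reduced_feasible b \<beta>. ereal (D_objective A a x X))"
  proof (rule INF_mono, clarify)
    fix x X v0 vb
    assume "(x, X, v0, vb) \<in> reduced_feasible b \<beta>"
    then have "(x, X) \<in> D_feasible b \<beta>"
      using reduced_feasible_projection by blast
    then show "\<exists>y\<in>D_feasible b \<beta>.
        (case y of (x, X) \<Rightarrow> ereal (D_objective A a x X)) \<le> ereal (D_objective A a x X)"
      by (intro bexI) auto
  qed
qed

text \<open>Multipliers with infinite dual value do not affect the infimum. The others project onto
  the feasible set of (D) and carry its objective, whichever domain defines the dual
  function.\<close>

lemma INF_dual_eq_INF_D:
  assumes projection: "\<And>x X. (\<exists>\<alpha> v0 vb. (\<alpha>, x, X, v0, vb) \<in> multipliers \<and>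
      dual_function \<Omega> A a b \<beta> (\<alpha>, x, X, v0, vb) < \<infinity>) \<longleftrightarrow> (x, X) \<in> D_feasible b \<beta>"
    and objective: "\<And>\<alpha> x X v0 vb. (\<alpha>, x, X, v0, vb) \<in> multipliers \<Longrightarrow>
      dual_function \<Omega> A a b \<beta> (\<alpha>, x, X, v0, vb) < \<infinity> \<Longrightarrow>
      dual_function \<Omega> A a b \<beta> (\<alpha>, x, X, v0, vb) = ereal (D_objective A a x X)"
  shows "(INF y\<in>multipliers. dual_function \<Omega> A a b \<beta> y) =
    (INF (x, X)\<in>D_feasible b \<beta>. ereal (D_objective A a x X))"
proof (rule antisym)
  show "(INF y\<in>multipliers. dual_function \<Omega> A a b \<beta> y) \<le>
      (INF (x, X)\<in>D_feasible b \<beta>. ereal (D_objective A a x X))"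
  proof (rule INF_mono, clarify)
    fix x X
    assume "(x, X) \<in> D_feasible b \<beta>"
    then obtain \<alpha> v0 vb where "(\<alpha>, x, X, v0, vb) \<in> multipliers"
      "dual_function \<Omega> A a b \<beta> (\<alpha>, x, X, v0, vb) < \<infinity>"
      using projection by blast
    then show "\<exists>y\<in>multipliers. dual_function \<Omega> A a b \<beta> y \<le> ereal (D_objective A a x X)"
      using objective by (metis order_refl)
  qed
next
  show "(INF (x, X)\<in>D_feasible b \<beta>. ereal (D_objective A a x X)) \<le>
      (INF y\<in>multipliers. dual_function \<Omega> A a b \<beta> y)"
  proof (rule INF_greatest)
    fix y :: "'a multiplier"
    assume y: "y \<in> multipliers"
    obtain \<alpha> x X v0 vb where y_eq: "y = (\<alpha>, x, X, v0, vb)" by (cases y)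
    show "(INF (x, X)\<in>D_feasible b \<beta>. ereal (D_objective A a x X)) \<le> dual_function \<Omega> A a b \<beta> y"
    proof (cases "dual_function \<Omega> A a b \<beta> y < \<infinity>")
      case True
      then have "(x, X) \<in> D_feasible b \<beta>"
        using projection y y_eq by blast
      moreover have "dual_function \<Omega> A a b \<beta> y = ereal (D_objective A a x X)"
        using True objective y y_eq by blast
      ultimately show ?thesis
        by (auto intro: INF_lower2)
    next
      case False
      then show ?thesis by simp
    qed
  qed
qed

lemma halfspace_dual_projection:
  "(\<exists>\<alpha> v0 vb. (\<alpha>, x, X, v0, vb) \<in> multipliers \<and>
      dual_function halfspace_domain A a b \<beta> (\<alpha>, x, X, v0, vb) < \<infinity>) \<longleftrightarrow>
    (x, X) \<in> D_feasible b \<beta>"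
  unfolding finite_halfspace_dual_iff reduced_feasible_projection[symmetric] by blast

lemma INF_halfspace_dual:
  "(INF y\<in>multipliers. dual_function halfspace_domain A a b \<beta> y) =
    (INF (x, X)\<in>D_feasible b \<beta>. ereal (D_objective A a x X))"
proof (rule INF_dual_eq_INF_D[OF halfspace_dual_projection])
  fix \<alpha> x X v0 vb
  assume "(\<alpha>, x, X, v0, vb) \<in> multipliers"
    and finite: "dual_function halfspace_domain A a b \<beta> (\<alpha>, x, X, v0, vb) < \<infinity>"
  then have "transpose X = X"
    using psd_bordered_symmetric by (auto simp: multipliers_def)
  with finite show "dual_function halfspace_domain A a b \<beta> (\<alpha>, x, X, v0, vb) =
      ereal (D_objective A a x X)"
    by (simp add: dual_function_halfspace D_objective_def split: if_splits)
qed

text \<open>Over the cone, finite values may occur with Xb - \<beta> x + vb nonzero, but no new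
  pairs (x, X) arise.\<close>

lemma INF_cone_dual:
  "(INF y\<in>multipliers. dual_function cone_domain A a b \<beta> y) =
    (INF (x, X)\<in>D_feasible b \<beta>. ereal (D_objective A a x X))"
proof (rule INF_dual_eq_INF_D[OF cone_dual_projection])
  fix \<alpha> x X v0 vb
  assume "(\<alpha>, x, X, v0, vb) \<in> multipliers"
    and finite: "dual_function cone_domain A a b \<beta> (\<alpha>, x, X, v0, vb) < \<infinity>"
  then have "transpose X = X"
    using psd_bordered_symmetric by (auto simp: multipliers_def)
  with finite show "dual_function cone_domain A a b \<beta> (\<alpha>, x, X, v0, vb) =
      ereal (D_objective A a x X)"
    by (simp add: dual_function_cone D_objective_def split: if_splits)
qed

theorem mainTheorem4:
  fixes A :: "real^'n^'n" and a b :: "real^'n" and \<beta> :: real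
  assumes "transpose A = A" and "indefinite A"
  shows
    "(\<forall>z l0 u0 u. l0 \<ge> 0 \<longrightarrow>
        (INF y\<in>multipliers. ereal (Lagrangian A a b \<beta> (z, l0, u0, u) y)) =
          (if (z, l0, u0, u) \<in> P_feasible A a b \<beta> then ereal z else -\<infinity>))
   \<and> (\<forall>\<alpha> x X v0 vb. transpose X = X \<longrightarrow>
        dual_function halfspace_domain A a b \<beta> (\<alpha>, x, X, v0, vb) =
          (if 1 - \<alpha> = 0 \<and> trace X - \<alpha> \<le> 0 \<and> X *v b - \<beta> *\<^sub>R x + vb = 0 \<and>
              - (b \<bullet> x) - v0 + \<beta> \<ge> 0
           then ereal (A \<bullet>\<bullet> X + 2 * (a \<bullet> x)) else \<infinity>))
   \<and> (\<forall>\<alpha> x X v0 vb. transpose X = X \<longrightarrow>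
        dual_function cone_domain A a b \<beta> (\<alpha>, x, X, v0, vb) =
          (if 1 - \<alpha> = 0 \<and> trace X - \<alpha> \<le> 0 \<and>
              norm (X *v b - \<beta> *\<^sub>R x + vb) \<le> - (b \<bullet> x) - v0 + \<beta>
           then ereal (A \<bullet>\<bullet> X + 2 * (a \<bullet> x)) else \<infinity>))
   \<and> {y \<in> multipliers. dual_function halfspace_domain A a b \<beta> y < \<infinity>} =
        {(\<alpha>, x, X, v0, vb). \<alpha> = 1 \<and> (x, X, v0, vb) \<in> reduced_feasible b \<beta>}
   \<and> {(x, X). \<exists>v0 vb. (x, X, v0, vb) \<in> reduced_feasible b \<beta>} = D_feasible b \<beta>
   \<and> {(x, X). \<exists>\<alpha> v0 vb. (\<alpha>, x, X, v0, vb) \<in> multipliers \<and>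
          dual_function cone_domain A a b \<beta> (\<alpha>, x, X, v0, vb) < \<infinity>} = D_feasible b \<beta>
   \<and> (INF y\<in>multipliers. dual_function halfspace_domain A a b \<beta> y) =
        (INF (x, X, v0, vb)\<in>reduced_feasible b \<beta>. ereal (D_objective A a x X))
   \<and> (INF y\<in>multipliers. dual_function cone_domain A a b \<beta> y) =
        (INF (x, X, v0, vb)\<in>reduced_feasible b \<beta>. ereal (D_objective A a x X))
   \<and> (INF (x, X, v0, vb)\<in>reduced_feasible b \<beta>. ereal (D_objective A a x X)) =
        (INF (x, X)\<in>D_feasible b \<beta>. ereal (D_objective A a x X))"
proof (intro conjI)
  show "{y \<in> multipliers. dual_function halfspace_domain A a b \<beta> y < \<infinity>} =
      {(\<alpha>, x, X, v0, vb). \<alpha> = 1 \<and> (x, X, v0, vb) \<in> reduced_feasible b \<beta>}"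
    by (simp only: set_eq_iff split_paired_all split_paired_All mem_Collect_eq case_prod_conv
        finite_halfspace_dual_iff simp_thms)
next
  show "{(x, X). \<exists>v0 vb. (x, X, v0, vb) \<in> reduced_feasible b \<beta>} = D_feasible b \<beta>"
    by (simp add: reduced_feasible_projection)
next
  show "{(x, X). \<exists>\<alpha> v0 vb. (\<alpha>, x, X, v0, vb) \<in> multipliers \<and>
      dual_function cone_domain A a b \<beta> (\<alpha>, x, X, v0, vb) < \<infinity>} = D_feasible b \<beta>"
    unfolding cone_dual_projection by auto
\<comment> \<open>Both infima over the multipliers meet that of the reduced problem at the value of
  (D).\<close>
qed (use assms(1) in \<open>auto simp only: INF_Lagrangian dual_function_halfspace dual_function_cone
    INF_halfspace_dual INF_cone_dual INF_reduced_eq_INF_D\<close>)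

end
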